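(* For every integer $s \ge 2$, the oriented graph $D_s$ is not tileable.
   Context: An oriented graph is a loopless directed graph with at most one of $uv$, $vu$ for each pair of distinct vertices; a tournament has exactly one. $\delta^0(G)$ denotes the minimum semi-degree, i.e. the minimum of all in- and out-degrees of vertices of $G$. An oriented graph $G$ on $n$ vertices with $\delta^0(G) = \lfloor (n-1)/2 \rfloor$ is called a semi-regular tournament. For an oriented graph $H$, an $H$-tiling in $G$ is a collection of vertex-disjoint copies of $H$ in $G$; it is perfect if it covers all vertices of $G$. An oriented graph $H$ on $h$ vertices is tileable if there exists $n_0$ such that every semi-regular tournament on $n \ge n_0$ vertices with $h \mid n$ contains a perfect $H$-tiling. For $s \ge 1$, $D_s$ is the tournament on $3s$ vertices whose vertex set is partitioned into three sets $A,B,C$ of size $s$, each inducing a transitive tournament, with all edges between distinct parts oriented from $A$ to $B$, from $B$ to $C$, and from $C$ to $A$. *)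

theory Defs
  imports "Graph_Theory.Graph_Theory"
begin

text \<open>
  \<^locale>\<open>pair_digraph\<close> already provides finiteness, looplessness and the absence of parallel arcs
  (arcs are ordered pairs of vertices). Degrees, \<^const>\<open>subgraph\<close> and \<^const>\<open>digraph_iso\<close>
  are applied to such graphs through the coercion \<^const>\<open>with_proj\<close>.
\<close>

locale oriented_graph = pair_digraph +
  assumes no_opposite_arcs: "(u, v) \<in> parcs G \<Longrightarrow> (v, u) \<notin> parcs G"

locale tournament = oriented_graph +
  assumes adjacent: "\<lbrakk>u \<in> pverts G; v \<in> pverts G; u \<noteq> v\<rbrakk> \<Longrightarrow> (u, v) \<in> parcs G \<or> (v, u) \<in> parcs G"

text \<open>Only meaningful for graphs with at least one vertex.\<close>

definition min_semidegree :: "'a pair_pre_digraph \<Rightarrow> nat" where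
  "min_semidegree G = Min (out_degree G ` pverts G \<union> in_degree G ` pverts G)"

text \<open>
  The name is a convention: the definition asks for an oriented graph of
  the given minimum semi-degree. For an odd number of vertices such a graph is a (regular)
  tournament; for an even number of vertices every vertex may be non-adjacent to at most one other
  vertex.
\<close>

definition semi_regular_tournament :: "'a pair_pre_digraph \<Rightarrow> bool" where
  "semi_regular_tournament G \<longleftrightarrow>
     oriented_graph G \<and> min_semidegree G = (card (pverts G) - 1) div 2"

text \<open>
  A copy of \<open>H\<close> in \<open>G\<close> is a (not necessarily induced) subgraph of \<open>G\<close> isomorphic to \<open>H\<close>.
\<close>

definition is_copy :: "'b pair_pre_digraph \<Rightarrow> 'a pair_pre_digraph \<Rightarrow> 'a pair_pre_digraph \<Rightarrow> bool" where
  "is_copy H G K \<longleftrightarrow> subgraph K G \<and> digraph_iso H K"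

definition is_tiling ::
    "'b pair_pre_digraph \<Rightarrow> 'a pair_pre_digraph \<Rightarrow> 'a pair_pre_digraph set \<Rightarrow> bool" where
  "is_tiling H G T \<longleftrightarrow>
     (\<forall>K\<in>T. is_copy H G K) \<and> pairwise (\<lambda>K L. disjnt (pverts K) (pverts L)) T"

definition is_perfect_tiling ::
    "'b pair_pre_digraph \<Rightarrow> 'a pair_pre_digraph \<Rightarrow> 'a pair_pre_digraph set \<Rightarrow> bool" where
  "is_perfect_tiling H G T \<longleftrightarrow> is_tiling H G T \<and> (\<Union>K\<in>T. pverts K) = pverts G"

text \<open>
  The vertices of the host graph \<open>G\<close> are natural numbers; since host graphs are finite,
  this covers all of them up to isomorphism.
\<close>

definition tileable :: "'b pair_pre_digraph \<Rightarrow> bool" where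
  "tileable H \<longleftrightarrow>
     (\<exists>n\<^sub>0. \<forall>G :: nat pair_pre_digraph.
        semi_regular_tournament G \<and> card (pverts G) \<ge> n\<^sub>0 \<and> card (pverts H) dvd card (pverts G)
        \<longrightarrow> (\<exists>T. is_perfect_tiling H G T))"

text \<open>
  The vertex \<open>(i, a)\<close> is the \<open>a\<close>-th vertex of the \<open>i\<close>-th part, the parts \<open>0, 1, 2\<close> being
  \<open>A, B, C\<close>.
\<close>

definition D :: "nat \<Rightarrow> (nat \<times> nat) pair_pre_digraph" where
  "D s = \<lparr> pverts = {0, 1, 2} \<times> {0..<s},
           parcs = {((i, a), (j, b)) | i a j b. i \<in> {0, 1, 2} \<and> j \<in> {0, 1, 2} \<and> a < s \<and> b < s \<and>
                      (i = j \<and> a < b \<or> (i, j) \<in> {(0, 1), (1, 2), (2, 0)})} \<rparr>"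

lemma pverts_D_iff: "(i, a) \<in> pverts (D s) \<longleftrightarrow> i \<in> {0, 1, 2} \<and> a < s"
  by (simp add: D_def)

lemma parcs_D_iff:
  "((i, a), (j, b)) \<in> parcs (D s) \<longleftrightarrow>
     i \<in> {0, 1, 2} \<and> j \<in> {0, 1, 2} \<and> a < s \<and> b < s \<and>
     (i = j \<and> a < b \<or> (i, j) \<in> {(0, 1), (1, 2), (2, 0)})"
  by (simp add: D_def)

lemma card_pverts_D: "card (pverts (D s)) = 3 * s"
  by (simp add: D_def card_cartesian_product)

lemma tournament_D: "tournament (D s)"
proof -
  have wf: "p \<in> pverts (D s) \<and> q \<in> pverts (D s)" if "(p, q) \<in> parcs (D s)" for p q
    using that by (cases p; cases q) (simp only: pverts_D_iff parcs_D_iff)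
  have loopfree: "p \<noteq> q" if "(p, q) \<in> parcs (D s)" for p q
    using that by (cases p; cases q) (auto simp: parcs_D_iff)
  have opp: "(q, p) \<notin> parcs (D s)" if "(p, q) \<in> parcs (D s)" for p q
    using that
    by (cases p; cases q)
      (simp only: parcs_D_iff insert_iff empty_iff prod.inject, presburger)
  have adj: "(p, q) \<in> parcs (D s) \<or> (q, p) \<in> parcs (D s)"
    if "p \<in> pverts (D s)" "q \<in> pverts (D s)" "p \<noteq> q" for p q
    using that
    by (cases p; cases q)
      (simp only: parcs_D_iff pverts_D_iff insert_iff empty_iff prod.inject, presburger)
  have finv: "finite (pverts (D s))"
    by (simp add: D_def)
  have "parcs (D s) \<subseteq> pverts (D s) \<times> pverts (D s)"
    using wf by (intro subrelI) (rule SigmaI; blast)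
  with finv have "finite (parcs (D s))"
    by (meson finite_SigmaI finite_subset)
  note fin = finv this
  show ?thesis
  proof unfold_locales
    fix e assume e: "e \<in> parcs (D s)"
    show "fst e \<in> pverts (D s)" and "snd e \<in> pverts (D s)"
      using wf[of "fst e" "snd e"] e by simp_all
    show "fst e \<noteq> snd e"
      using loopfree[of "fst e" "snd e"] e by simp
  qed (fact fin opp adj)+
qed

end

theory Submission
  imports Defs
begin

text \<open>
  Take \<open>k = s t\<close> and blow up a cyclic triangle to parts \<open>A\<close>, \<open>B\<close>, \<open>C\<close> of the unequal sizes
  \<open>2k + 1\<close>, \<open>2k - 1\<close>, \<open>2k\<close>, with a rotational (almost) tournament inside each part. Reversing a
  matching of \<open>2k\<close> arcs from \<open>C\<close> to \<open>A\<close> balances all degrees. No vertex of \<open>D\<^sub>s\<close> can be moved out of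
  its part without creating \<open>s \<ge> 2\<close> reversed arcs at that vertex, which the matching does not
  provide; hence a copy of \<open>D\<^sub>s\<close> meets \<open>B\<close> in \<open>0\<close>, \<open>s\<close> or \<open>3s\<close> vertices. As \<open>s\<close> divides \<open>2k\<close>, it does
  not divide \<open>|B|\<close>, and there is no perfect tiling.
\<close>

section \<open>Partitions of D s\<close>

text \<open>Writing the cyclic successor of a part as \<open>Suc i mod 3\<close> lets the argument
  below treat all three parts at once.\<close>

lemma parcs_D_next:
  assumes "i < 3" "a < s" "b < s"
  shows "((i, a), (Suc i mod 3, b)) \<in> parcs (D s)"
proof -
  have "i = 0 \<or> i = 1 \<or> i = 2"
    using assms by auto
  then show ?thesis
    using assms by (auto simp: parcs_D_iff)
qed

text \<open>\<open>X\<close>, \<open>Y\<close>, \<open>Z\<close> stand for the vertices of a copy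
  lying in A, B, C; the arcs from \<open>X\<close> to \<open>Z\<close> form a matching. If
  \<open>Y\<close> meets two parts, it absorbs all vertices; if it meets just one, it contains all
  of that part.\<close>

lemma card_class_dvd:
  assumes "s \<ge> 2"
    and V: "pverts (D s) = X \<union> Y \<union> Z"
    and disj: "X \<inter> Y = {}" "Y \<inter> Z = {}" "X \<inter> Z = {}"
    and XY: "\<And>x y. x \<in> X \<Longrightarrow> y \<in> Y \<Longrightarrow> (y, x) \<notin> parcs (D s)"
    and YZ: "\<And>y z. y \<in> Y \<Longrightarrow> z \<in> Z \<Longrightarrow> (z, y) \<notin> parcs (D s)"
    and out_le_1: "\<And>x z z'. x \<in> X \<Longrightarrow> z \<in> Z \<Longrightarrow> z' \<in> Z \<Longrightarrow>
          (x, z) \<in> parcs (D s) \<Longrightarrow> (x, z') \<in> parcs (D s) \<Longrightarrow> z = z'"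
    and in_le_1: "\<And>x x' z. x \<in> X \<Longrightarrow> x' \<in> X \<Longrightarrow> z \<in> Z \<Longrightarrow>
          (x, z) \<in> parcs (D s) \<Longrightarrow> (x', z) \<in> parcs (D s) \<Longrightarrow> x = x'"
  shows "s dvd card Y"
proof -
  have V': "pverts (D s) = {..<3} \<times> {..<s}"
    by (auto simp: D_def)
  have mem: "(i, a) \<in> X \<or> (i, a) \<in> Y \<or> (i, a) \<in> Z" if "i < 3" "a < s" for i a
    using that V V' by blast
  have Y_sub: "Y \<subseteq> {..<3} \<times> {..<s}"
    using V V' by blast
  have third: "(Suc (Suc i) mod 3, c) \<in> Y"
    if i: "i < 3" and c: "c < s" and p: "(i, a) \<in> Y" and q: "(Suc i mod 3, b) \<in> Y" for i a b c
  proof -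
    have "i = 0 \<or> i = 1 \<or> i = 2"
      using i by auto
    then have s3: "Suc (Suc (Suc i) mod 3) mod 3 = i" "Suc (Suc i mod 3) mod 3 = Suc (Suc i) mod 3"
      by auto
    have ab: "a < s" "b < s"
      using p q Y_sub by auto
    \<comment> \<open>This arc into \<open>Y\<close> keeps the vertex out of \<open>Z\<close>; the
      next one, leaving \<open>Y\<close>, keeps it out of \<open>X\<close>.\<close>
    have "((Suc (Suc i) mod 3, c), (i, a)) \<in> parcs (D s)"
      using parcs_D_next[of "Suc (Suc i) mod 3" c s a] c ab s3 by simp
    moreover have "((Suc i mod 3, b), (Suc (Suc i) mod 3, c)) \<in> parcs (D s)"
      using parcs_D_next[of "Suc i mod 3" b s c] c ab s3 by simp
    ultimately show ?thesis
      using mem[of "Suc (Suc i) mod 3" c] c XY[OF _ q] YZ[OF p] by auto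
  qed
  show ?thesis
  \<comment> \<open>Any two distinct parts are cyclically consecutive in one order, so this case
    says that \<open>Y\<close> meets at least two parts.\<close>
  proof (cases "\<exists>i a b. i < 3 \<and> (i, a) \<in> Y \<and> (Suc i mod 3, b) \<in> Y")
    case True
    then obtain i a b where i: "i < 3" and p: "(i, a) \<in> Y" and q: "(Suc i mod 3, b) \<in> Y"
      by blast
    have i3: "i = 0 \<or> i = 1 \<or> i = 2"
      using i by auto
    have r: "(Suc (Suc i) mod 3, c) \<in> Y" if "c < s" for c
      using third i p q that by blast
    \<comment> \<open>A filled part and a known vertex of another part again form a consecutive
      pair, so \<open>third\<close> can be rotated around the triangle.\<close>
    have p': "(i, c) \<in> Y" if c: "c < s" for c
      using third[of "Suc i mod 3" c b c] q r[OF c] c i3 by (auto simp: numeral_2_eq_2)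
    have q': "(Suc i mod 3, c) \<in> Y" if c: "c < s" for c
      using third[of "Suc (Suc i) mod 3" c c a] p r[OF c] c i3 by (auto simp: numeral_2_eq_2)
    have "{..<3} \<times> {..<s} \<subseteq> Y"
    proof (clarsimp)
      fix j c :: nat assume "j < 3" and c: "c < s"
      then have "j = i \<or> j = Suc i mod 3 \<or> j = Suc (Suc i) mod 3"
        using i3 by auto
      then show "(j, c) \<in> Y"
        using p' q' r c by blast
    qed
    with Y_sub have "Y = {..<3} \<times> {..<s}"
      by blast
    then show ?thesis
      by (simp add: card_cartesian_product)
  next
    case no_two: False
    show ?thesis
    proof (cases "Y = {}")
      case False
      then obtain i a where p: "(i, a) \<in> Y"
        by auto
      with Y_sub have i: "i < 3" and a: "a < s"
        by auto
      have i3: "i = 0 \<or> i = 1 \<or> i = 2"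
        using i by auto
      \<comment> \<open>Arcs out of \<open>(i, a)\<close> avoid \<open>X\<close>, and
        \<open>Y\<close> meets no second part, so the next part lies in \<open>Z\<close>. By the
        mirrored argument the previous part lies in \<open>X\<close>.\<close>
      have next_Z: "(Suc i mod 3, b) \<in> Z" if b: "b < s" for b
        using mem[of "Suc i mod 3" b] XY[OF _ p, of "(Suc i mod 3, b)"] no_two i a b p
          parcs_D_next[OF i a b] by auto
      have prev_arc: "((Suc (Suc i) mod 3, b), (i, c)) \<in> parcs (D s)" if "b < s" "c < s" for b c
        using parcs_D_next[of "Suc (Suc i) mod 3" b s c] i3 that by (auto simp: numeral_2_eq_2)
      have prev_notin_Y: "(Suc (Suc i) mod 3, b) \<notin> Y" for b
      proof
        assume "(Suc (Suc i) mod 3, b) \<in> Y"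
        moreover have "(Suc (Suc (Suc i) mod 3) mod 3, a) \<in> Y"
          using p i3 by (auto simp: numeral_2_eq_2)
        moreover have "Suc (Suc i) mod 3 < 3"
          by simp
        ultimately show False
          using no_two by blast
      qed
      have prev_X: "(Suc (Suc i) mod 3, b) \<in> X" if b: "b < s" for b
        using mem[of "Suc (Suc i) mod 3" b] YZ[OF p, of "(Suc (Suc i) mod 3, b)"] prev_notin_Y b
          prev_arc[OF b a] by auto
      have "(i, c) \<in> Y" if c: "c < s" for c
      proof (rule ccontr)
        assume "(i, c) \<notin> Y"
        then consider "(i, c) \<in> X" | "(i, c) \<in> Z"
          using mem[OF i c] by blast
        then show False
        proof cases
          \<comment> \<open>In \<open>X\<close>, the vertex would have two out-neighbours in
            \<open>Z\<close>; in \<open>Z\<close>, it would have two in-neighbours in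
            \<open>X\<close>. Indices 0 and 1 exist because \<open>s \<ge> 2\<close>.\<close>
          case 1
          show False
            using out_le_1[OF 1 next_Z[of 0] next_Z[of 1]] parcs_D_next[OF i c] \<open>s \<ge> 2\<close> by auto
        next
          case 2
          show False
            using in_le_1[OF prev_X[of 0] prev_X[of 1] 2] prev_arc[of _ c] c \<open>s \<ge> 2\<close> by auto
        qed
      qed
      moreover have "j = i" if "(j, c) \<in> Y" for j c
      proof -
        have "j < 3"
          using that Y_sub by auto
        then have "j = i \<or> j = Suc i mod 3 \<or> j = Suc (Suc i) mod 3"
          using i3 by auto
        then show ?thesis
          using that prev_notin_Y no_two i p by blast
      qed
      ultimately have "Y = {i} \<times> {..<s}"
        using Y_sub by auto
      then show ?thesis
        by (simp add: card_cartesian_product)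
    qed simp
  qed
qed

section \<open>The host graph\<close>

text \<open>
  \<open>cyc N u v\<close> describes the rotational orientation on any \<open>N\<close> consecutive numbers: \<open>v\<close> is one of
  the \<open>(N - 1) div 2\<close> cyclic successors of \<open>u\<close>. For even \<open>N\<close>, antipodal pairs are non-adjacent.
\<close>

definition cyc :: "nat \<Rightarrow> nat \<Rightarrow> nat \<Rightarrow> bool" where
  "cyc N u v \<longleftrightarrow> u < v \<and> v \<le> u + (N - 1) div 2 \<or> v + N \<le> u + (N - 1) div 2"

text \<open>The cut points \<open>2 * k + 1\<close> and \<open>4 * k\<close> separate A, B and C.
  The reversed matching pairs \<open>u\<close> with \<open>u + 4 * k\<close>: within the host it
  covers C and misses only the vertex \<open>2 * k\<close> of A.\<close>

definition host_arc :: "nat \<Rightarrow> nat \<Rightarrow> nat \<Rightarrow> bool" where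
  "host_arc k u v \<longleftrightarrow>
     (if u < 2 * k + 1 then
        if v < 2 * k + 1 then cyc (2 * k + 1) u v
        else if v < 4 * k then True else v = u + 4 * k
      else if u < 4 * k then
        if v < 2 * k + 1 then False
        else if v < 4 * k then cyc (2 * k - 1) u v else True
      else
        if v < 2 * k + 1 then u \<noteq> v + 4 * k
        else if v < 4 * k then False else cyc (2 * k) u v)"

definition host :: "nat \<Rightarrow> nat pair_pre_digraph" where
  "host k = \<lparr> pverts = {..<6 * k}, parcs = {(u, v). u < 6 * k \<and> v < 6 * k \<and> host_arc k u v} \<rparr>"

lemma host_simps [simp]:
  "pverts (host k) = {..<6 * k}"
  "(u, v) \<in> parcs (host k) \<longleftrightarrow> u < 6 * k \<and> v < 6 * k \<and> host_arc k u v"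
  by (simp_all add: host_def)

text \<open>The two cyclic distances between distinct points add up to \<open>N\<close>, so they
  cannot both be at most \<open>(N - 1) div 2\<close>.\<close>

lemma cyc_asym:
  assumes "o' \<le> u" "u < o' + N" "o' \<le> v" "v < o' + N" "cyc N u v"
  shows "\<not> cyc N v u"
proof -
  have "2 * ((N - 1) div 2) < N"
    using assms(1,2) by linarith
  then show ?thesis
    using assms unfolding cyc_def by auto
qed

lemma host_arc_asym:
  assumes "u < 6 * k" "v < 6 * k" "host_arc k u v"
  shows "\<not> host_arc k v u"
proof -
  consider "u < 2 * k + 1" "v < 2 * k + 1" | "2 * k + 1 \<le> u" "u < 4 * k" "2 * k + 1 \<le> v" "v < 4 * k"
    | "2 * k + 1 \<le> u" "4 * k \<le> u" "2 * k + 1 \<le> v" "4 * k \<le> v"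
    | "(u < 2 * k + 1) \<noteq> (v < 2 * k + 1) \<or> (u < 4 * k) \<noteq> (v < 4 * k)"
    by (meson not_less)
  then show ?thesis
  proof cases
    case 1
    then show ?thesis
      using assms cyc_asym[of 0 u "2 * k + 1" v] by (simp add: host_arc_def)
  next
    case 2
    then show ?thesis
      using assms cyc_asym[of "2 * k + 1" u "2 * k - 1" v] by (simp add: host_arc_def)
  next
    case 3
    then show ?thesis
      using assms cyc_asym[of "4 * k" u "2 * k" v] by (simp add: host_arc_def)
  next
    case 4
    then show ?thesis
      using assms by (auto simp: host_arc_def split: if_splits)
  qed
qed

lemma oriented_graph_host: "oriented_graph (host k)"
proof
  show "finite (parcs (host k))"
    by (rule finite_subset[of _ "{..<6 * k} \<times> {..<6 * k}"]) (auto simp: host_def)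
next
  fix e assume "e \<in> parcs (host k)"
  moreover obtain u v where "e = (u, v)"
    by force
  ultimately show "fst e \<in> pverts (host k)" "snd e \<in> pverts (host k)" "fst e \<noteq> snd e"
    using host_arc_asym[of u k u] by auto
qed (use host_arc_asym in auto)

section \<open>Degree counts\<close>

lemma card_cyc_out:
  assumes "o' \<le> u" "u < o' + N"
  shows "card {v. o' \<le> v \<and> v < o' + N \<and> cyc N u v} = (N - 1) div 2"
proof -
  define h where "h = (N - 1) div 2"
  have "h < N"
    using assms unfolding h_def by linarith
  \<comment> \<open>The successors split into those after \<open>u\<close> and those that wrap
    around. Without wrapping, truncated subtraction makes the second piece empty.\<close>
  have "{v. o' \<le> v \<and> v < o' + N \<and> cyc N u v} = {u<..<min (Suc (u + h)) (o' + N)} \<union> {o'..<Suc (u + h) - N}"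
    using assms \<open>h < N\<close> unfolding cyc_def h_def[symmetric] by auto
  also have "card \<dots> = card {u<..<min (Suc (u + h)) (o' + N)} + card {o'..<Suc (u + h) - N}"
    using \<open>h < N\<close> by (intro card_Un_disjoint) auto
  also have "\<dots> = h"
    using assms \<open>h < N\<close> by (auto simp: min_def)
  finally show ?thesis
    by (simp add: h_def)
qed

lemma card_cyc_in:
  assumes "o' \<le> u" "u < o' + N"
  shows "card {v. o' \<le> v \<and> v < o' + N \<and> cyc N v u} = (N - 1) div 2"
proof -
  define h where "h = (N - 1) div 2"
  have "h < N"
    using assms unfolding h_def by linarith
  have "{v. o' \<le> v \<and> v < o' + N \<and> cyc N v u} = {max o' (u - h)..<u} \<union> {u + N - h..<o' + N}"
    using assms \<open>h < N\<close> unfolding cyc_def h_def[symmetric] by auto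
  also have "card \<dots> = card {max o' (u - h)..<u} + card {u + N - h..<o' + N}"
    using \<open>h < N\<close> by (intro card_Un_disjoint) auto
  also have "\<dots> = h"
    using assms \<open>h < N\<close> by (auto simp: max_def)
  finally show ?thesis
    by (simp add: h_def)
qed

lemma out_degree_pair: "out_degree (with_proj G) u = card {v. (u, v) \<in> parcs G}"
proof -
  have "out_arcs (with_proj G) u = Pair u ` {v. (u, v) \<in> parcs G}"
    by (auto simp: out_arcs_def)
  then show ?thesis
    by (simp add: out_degree_def card_image inj_on_def)
qed

lemma in_degree_pair: "in_degree (with_proj G) u = card {v. (v, u) \<in> parcs G}"
proof -
  have "in_arcs (with_proj G) u = (\<lambda>v. (v, u)) ` {v. (v, u) \<in> parcs G}"
    by (auto simp: in_arcs_def)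
  then show ?thesis
    by (simp add: in_degree_def card_image inj_on_def)
qed

lemma card_by_parts:
  fixes k :: nat
  assumes "k \<ge> 1"
  shows "card {v. v < 6 * k \<and> P v} = card {v. v < 2 * k + 1 \<and> P v}
    + card {v. 2 * k + 1 \<le> v \<and> v < 4 * k \<and> P v} + card {v. 4 * k \<le> v \<and> v < 6 * k \<and> P v}"
proof -
  let ?A = "{v. v < 2 * k + 1 \<and> P v}"
  let ?B = "{v. 2 * k + 1 \<le> v \<and> v < 4 * k \<and> P v}"
  let ?C = "{v. 4 * k \<le> v \<and> v < 6 * k \<and> P v}"
  have fin: "finite ?A" "finite ?B" "finite ?C"
    by (rule finite_subset[of _ "{..<6 * k + 1}"]; auto)+
  have "?A \<inter> ?B = {}"
    by auto
  then have "card (?A \<union> ?B) = card ?A + card ?B"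
    by (rule card_Un_disjoint[OF fin(1,2)])
  moreover have "(?A \<union> ?B) \<inter> ?C = {}"
    using assms by auto
  then have "card (?A \<union> ?B \<union> ?C) = card (?A \<union> ?B) + card ?C"
    using fin by (intro card_Un_disjoint) blast+
  moreover have "{v. v < 6 * k \<and> P v} = ?A \<union> ?B \<union> ?C"
    using assms by auto
  ultimately show ?thesis
    by (simp only:)
qed

text \<open>A vertex of A has \<open>k + (2 * k - 1)\<close> out-arcs, plus one if matched; in B
  there are \<open>(k - 1) + 2 * k\<close>; in C there are \<open>2 * k + (k - 1)\<close>, one arc
  into A being lost to the matching.\<close>

lemma out_degree_host:
  assumes k: "k \<ge> 1" and u: "u < 6 * k"
  shows "out_degree (host k) u = (if u < 2 * k then 3 * k else 3 * k - 1)"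
proof -
  have "out_degree (host k) u = card {v. v < 6 * k \<and> host_arc k u v}"
    using u by (simp add: out_degree_pair)
  also have "\<dots> = card {v. v < 2 * k + 1 \<and> host_arc k u v}
    + card {v. 2 * k + 1 \<le> v \<and> v < 4 * k \<and> host_arc k u v}
    + card {v. 4 * k \<le> v \<and> v < 6 * k \<and> host_arc k u v}"
    (is "_ = card ?A + card ?B + card ?C")
    using card_by_parts[OF k] .
  also consider "u < 2 * k + 1" | "2 * k + 1 \<le> u" "u < 4 * k" | "4 * k \<le> u"
    by linarith
  then have "card ?A + card ?B + card ?C = (if u < 2 * k then 3 * k else 3 * k - 1)"
  proof cases
    case 1
    have "?A = {v. 0 \<le> v \<and> v < 0 + (2 * k + 1) \<and> cyc (2 * k + 1) u v}"
      using 1 by (auto simp: host_arc_def)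
    then have "card ?A = k"
      using card_cyc_out[of 0 u "2 * k + 1"] 1 by simp
    moreover have "?B = {2 * k + 1..<4 * k}"
      using 1 by (auto simp: host_arc_def)
    moreover have "?C = (if u < 2 * k then {u + 4 * k} else {})"
      using 1 k by (auto simp: host_arc_def)
    ultimately show ?thesis
      using k by (auto simp del: card_0_eq card_eq_0_iff)
  next
    case 2
    have "?A = {}"
      using 2 by (auto simp: host_arc_def)
    then have "card ?A = 0"
      by (simp only: card.empty)
    moreover have "?B = {v. 2 * k + 1 \<le> v \<and> v < 2 * k + 1 + (2 * k - 1) \<and> cyc (2 * k - 1) u v}"
      using 2 by (auto simp: host_arc_def)
    then have "card ?B = k - 1"
      using card_cyc_out[of "2 * k + 1" u "2 * k - 1"] 2 by simp
    moreover have "?C = {4 * k..<6 * k}"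
      using 2 by (auto simp: host_arc_def)
    ultimately show ?thesis
      using 2 by (simp del: card_0_eq card_eq_0_iff)
  next
    case 3
    have "?A = {..<2 * k + 1} - {u - 4 * k}"
      using 3 k by (auto simp: host_arc_def)
    then have "card ?A = 2 * k"
      using 3 u by simp
    moreover have "?B = {}"
      using 3 by (auto simp: host_arc_def)
    then have "card ?B = 0"
      by (simp only: card.empty)
    moreover have "?C = {v. 4 * k \<le> v \<and> v < 4 * k + 2 * k \<and> cyc (2 * k) u v}"
      using 3 k by (auto simp: host_arc_def)
    then have "card ?C = (2 * k - 1) div 2"
      using card_cyc_out[of "4 * k" u "2 * k"] 3 u by simp
    ultimately show ?thesis
      using 3 k by (simp del: card_0_eq card_eq_0_iff)
  qed
  finally show ?thesis .
qed

text \<open>A vertex of A receives \<open>k + 2 * k\<close> arcs, less one if matched; in B there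
  are \<open>(2 * k + 1) + (k - 1)\<close>; in C there are
  \<open>1 + (2 * k - 1) + (k - 1)\<close>.\<close>

lemma in_degree_host:
  assumes k: "k \<ge> 1" and u: "u < 6 * k"
  shows "in_degree (host k) u = (if 2 * k \<le> u \<and> u < 4 * k then 3 * k else 3 * k - 1)"
proof -
  have "in_degree (host k) u = card {v. v < 6 * k \<and> host_arc k v u}"
    using u by (simp add: in_degree_pair)
  also have "\<dots> = card {v. v < 2 * k + 1 \<and> host_arc k v u}
    + card {v. 2 * k + 1 \<le> v \<and> v < 4 * k \<and> host_arc k v u}
    + card {v. 4 * k \<le> v \<and> v < 6 * k \<and> host_arc k v u}"
    (is "_ = card ?A + card ?B + card ?C")
    using card_by_parts[OF k] .
  also consider "u < 2 * k + 1" | "2 * k + 1 \<le> u" "u < 4 * k" | "4 * k \<le> u"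
    by linarith
  then have "card ?A + card ?B + card ?C = (if 2 * k \<le> u \<and> u < 4 * k then 3 * k else 3 * k - 1)"
  proof cases
    case 1
    have "?A = {v. 0 \<le> v \<and> v < 0 + (2 * k + 1) \<and> cyc (2 * k + 1) v u}"
      using 1 by (auto simp: host_arc_def)
    then have "card ?A = k"
      using card_cyc_in[of 0 u "2 * k + 1"] 1 by simp
    moreover have "?B = {}"
      using 1 by (auto simp: host_arc_def)
    then have "card ?B = 0"
      by (simp only: card.empty)
    moreover have "?C = {4 * k..<6 * k} - {u + 4 * k}"
      using 1 k by (auto simp: host_arc_def)
    then have "card ?C = (if u < 2 * k then 2 * k - 1 else 2 * k)"
      using 1 by simp
    ultimately show ?thesis
      using 1 k by (auto simp del: card_0_eq card_eq_0_iff)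
  next
    case 2
    have "?A = {..<2 * k + 1}"
      using 2 by (auto simp: host_arc_def)
    moreover have "?B = {v. 2 * k + 1 \<le> v \<and> v < 2 * k + 1 + (2 * k - 1) \<and> cyc (2 * k - 1) v u}"
      using 2 by (auto simp: host_arc_def)
    then have "card ?B = k - 1"
      using card_cyc_in[of "2 * k + 1" u "2 * k - 1"] 2 by simp
    moreover have "?C = {}"
      using 2 by (auto simp: host_arc_def)
    then have "card ?C = 0"
      by (simp only: card.empty)
    ultimately show ?thesis
      using 2 k by (simp del: card_0_eq card_eq_0_iff)
  next
    case 3
    have "?A = {u - 4 * k}"
      using 3 k u by (auto simp: host_arc_def)
    moreover have "?B = {2 * k + 1..<4 * k}"
      using 3 by (auto simp: host_arc_def)
    moreover have "?C = {v. 4 * k \<le> v \<and> v < 4 * k + 2 * k \<and> cyc (2 * k) v u}"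
      using 3 k by (auto simp: host_arc_def)
    then have "card ?C = (2 * k - 1) div 2"
      using card_cyc_in[of "4 * k" u "2 * k"] 3 u by simp
    ultimately show ?thesis
      using 3 k by (simp del: card_0_eq card_eq_0_iff)
  qed
  finally show ?thesis .
qed

lemma semi_regular_tournament_host:
  assumes "k \<ge> 1"
  shows "semi_regular_tournament (host k)"
proof -
  have "min_semidegree (host k) = 3 * k - 1"
    unfolding min_semidegree_def
  proof (rule Min_eqI)
    \<comment> \<open>The witness \<open>4 * k\<close> is the first vertex of C.\<close>
    show "3 * k - 1 \<in> out_degree (host k) ` pverts (host k) \<union> in_degree (host k) ` pverts (host k)"
      using assms by (intro UnI1 image_eqI[of _ _ "4 * k"]) (auto simp: out_degree_host)
  qed (use assms in \<open>auto simp: out_degree_host in_degree_host\<close>)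
  then show ?thesis
    using assms oriented_graph_host by (simp add: semi_regular_tournament_def)
qed

section \<open>Copies in the host graph\<close>

text \<open>Reduces a copy, whose isomorphism also carries separate arc, tail and head maps, to an
  injective vertex map.\<close>

lemma is_copy_embedding:
  assumes "is_copy H G K"
  obtains f where "inj_on f (pverts H)" "pverts K = f ` pverts H" "pverts K \<subseteq> pverts G"
    "\<And>u v. (u, v) \<in> parcs H \<Longrightarrow> (f u, f v) \<in> parcs G"
proof -
  from assms obtain h where h: "pre_digraph.digraph_isomorphism (with_proj H) h"
    and K: "with_proj K = app_iso h (with_proj H)" and sub: "subgraph K G"
    by (auto simp: is_copy_def digraph_iso_def)
  \<comment> \<open>Comparing record fields shows that the tail and head maps of \<open>h\<close>
    are the projections, so an arc must go to the pair of images of its ends.\<close>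
  have K_simps: "pverts K = iso_verts h ` pverts H" "parcs K = iso_arcs h ` parcs H"
    "fst = iso_tail h" "snd = iso_head h"
    using arg_cong[OF K, of verts] arg_cong[OF K, of arcs] arg_cong[OF K, of tail]
      arg_cong[OF K, of head] by simp_all
  have "(iso_verts h u, iso_verts h v) \<in> parcs G" if uv: "(u, v) \<in> parcs H" for u v
  proof -
    have "iso_tail h (iso_arcs h (u, v)) = iso_verts h u" "iso_head h (iso_arcs h (u, v)) = iso_verts h v"
      using h uv unfolding pre_digraph.digraph_isomorphism_def by force+
    then have "iso_arcs h (u, v) = (iso_verts h u, iso_verts h v)"
      by (simp add: K_simps(3,4)[symmetric] prod_eq_iff)
    moreover have "iso_arcs h (u, v) \<in> parcs G"
      using uv K_simps(2) sub by (auto simp: subgraph_def)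
    ultimately show ?thesis
      by simp
  qed
  moreover have "inj_on (iso_verts h) (pverts H)"
    using h by (simp add: pre_digraph.digraph_isomorphism_def)
  moreover have "pverts K \<subseteq> pverts G"
    using sub by (simp add: subgraph_def)
  ultimately show ?thesis
    using that K_simps(1) by blast
qed

text \<open>Pulling A, B, C back along the embedding gives classes as in
  \<open>card_class_dvd\<close>: arcs of a copy become host arcs, and none of these goes from B to A
  or from C to B.\<close>

lemma card_copy_Int_dvd:
  assumes s: "s \<ge> 2" and copy: "is_copy (D s) (host k) K"
  shows "s dvd card (pverts K \<inter> {2 * k + 1..<4 * k})"
proof -
  obtain f where inj: "inj_on f (pverts (D s))" and K: "pverts K = f ` pverts (D s)"
    and sub: "pverts K \<subseteq> pverts (host k)"
    and arc: "\<And>u v. (u, v) \<in> parcs (D s) \<Longrightarrow> (f u, f v) \<in> parcs (host k)"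
    using is_copy_embedding[OF copy] by metis
  define X where "X = {v \<in> pverts (D s). f v < 2 * k + 1}"
  define Y where "Y = {v \<in> pverts (D s). 2 * k + 1 \<le> f v \<and> f v < 4 * k}"
  define Z where "Z = {v \<in> pverts (D s). 2 * k + 1 \<le> f v \<and> 4 * k \<le> f v}"
  note XYZ = X_def Y_def Z_def
  have arc': "host_arc k (f u) (f v)" if "(u, v) \<in> parcs (D s)" for u v
    using arc[OF that] by simp
  have "s dvd card Y"
  proof (rule card_class_dvd[OF s])
    show "pverts (D s) = X \<union> Y \<union> Z"
      unfolding XYZ by auto
    show "(y, x) \<notin> parcs (D s)" if "x \<in> X" "y \<in> Y" for x y
      using that arc'[of y x] by (auto simp: XYZ host_arc_def)
    show "(z, y) \<notin> parcs (D s)" if "y \<in> Y" "z \<in> Z" for y z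
      using that arc'[of z y] by (auto simp: XYZ host_arc_def)
    \<comment> \<open>The only host arcs from A to C are those of the matching, so either end
      determines the other.\<close>
    have matched: "f z = f x + 4 * k" if "x \<in> X" "z \<in> Z" "(x, z) \<in> parcs (D s)" for x z
      using that arc'[of x z] by (auto simp: XYZ host_arc_def)
    show "z = z'" if "x \<in> X" "z \<in> Z" "z' \<in> Z" "(x, z) \<in> parcs (D s)" "(x, z') \<in> parcs (D s)"
      for x z z'
      using matched[OF that(1,2,4)] matched[OF that(1,3,5)] that(2,3)
      by (intro inj_onD[OF inj]) (auto simp: Z_def)
    show "x = x'" if "x \<in> X" "x' \<in> X" "z \<in> Z" "(x, z) \<in> parcs (D s)" "(x', z) \<in> parcs (D s)"
      for x x' z
      using matched[OF that(1,3,4)] matched[OF that(2,3,5)] that(1,2)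
      by (intro inj_onD[OF inj]) (auto simp: X_def)
  qed (auto simp: XYZ)
  moreover have "pverts K \<inter> {2 * k + 1..<4 * k} = f ` Y"
    unfolding K Y_def by auto
  moreover have "card (f ` Y) = card Y"
    using inj by (intro card_image) (auto simp: Y_def intro: inj_on_subset)
  ultimately show ?thesis
    by simp
qed

section \<open>Contradiction from divisibility\<close>

theorem theorem1p10:
  fixes s :: nat
  assumes "s \<ge> 2"
  shows "\<not> tileable (D s)"
proof
  assume "tileable (D s)"
  then obtain n0 where n0: "\<And>G :: nat pair_pre_digraph. semi_regular_tournament G \<Longrightarrow>
      card (pverts G) \<ge> n0 \<Longrightarrow> card (pverts (D s)) dvd card (pverts G) \<Longrightarrow>
      \<exists>T. is_perfect_tiling (D s) G T"
    unfolding tileable_def by blast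
  \<comment> \<open>The factor \<open>s\<close> gives \<open>s dvd 2 * k\<close> and
    \<open>3 * s dvd 6 * k\<close>; the factor \<open>Suc n0\<close> makes the host large
    enough.\<close>
  define k where "k = s * Suc n0"
  have k: "k \<ge> 1" "k \<ge> n0"
    using assms by (simp_all add: k_def trans_le_add2)
  have "card (pverts (D s)) dvd card (pverts (host k))"
    by (simp add: card_pverts_D k_def)
  then obtain T where "is_perfect_tiling (D s) (host k) T"
    using n0[of "host k"] semi_regular_tournament_host k by auto
  then have copy: "\<And>K. K \<in> T \<Longrightarrow> is_copy (D s) (host k) K"
    and disj: "pairwise (\<lambda>K L. disjnt (pverts K) (pverts L)) T"
    and cover: "(\<Union>K\<in>T. pverts K) = {..<6 * k}"
    by (auto simp: is_perfect_tiling_def is_tiling_def)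
  define B where "B = {2 * k + 1..<4 * k}"
  \<comment> \<open>Copies that miss \<open>B\<close> all contribute the same empty set; this is
    harmless, as \<open>dvd_partition\<close> asks only distinct members to be disjoint.\<close>
  define \<C> where "\<C> = (\<lambda>K. pverts K \<inter> B) ` T"
  have union: "\<Union>\<C> = B"
    using cover unfolding \<C>_def B_def by auto
  then have "finite (\<Union>\<C>)"
    by (simp add: B_def)
  moreover have "\<forall>c\<in>\<C>. s dvd card c"
    using card_copy_Int_dvd[OF assms copy] by (auto simp: \<C>_def B_def)
  moreover have "\<forall>c\<in>\<C>. \<forall>d\<in>\<C>. c \<noteq> d \<longrightarrow> c \<inter> d = {}"
  proof (unfold \<C>_def, intro ballI impI, elim imageE)
    fix c d K L
    assume "c \<noteq> d" "c = pverts K \<inter> B" "d = pverts L \<inter> B" "K \<in> T" "L \<in> T"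
    moreover from this have "K \<noteq> L"
      by blast
    ultimately show "c \<inter> d = {}"
      using pairwiseD[OF disj] by (auto simp: disjnt_def)
  qed
  ultimately have "s dvd card (\<Union>\<C>)"
    by (rule dvd_partition)
  then have "s dvd 2 * k - 1"
    by (simp add: union B_def)
  moreover have "s dvd 2 * k"
    by (simp add: k_def)
  ultimately have "s dvd 2 * k - (2 * k - 1)"
    by (rule dvd_diff_nat[rotated])
  then show False
    using assms k by simp
qed

end
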